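(* Let $X$ be a Calabi-Yau threefold with genus zero Gopakumar-Vafa invariants $n^0_\beta$, $\beta\in H_2(X,\mathbb{Z})$, $\beta>0$, and let $$\tilde{F}_{GV_0}(\lambda,t)=\sum_{\beta>0}n^0_\beta\sum_{k\ge1}\frac{1}{k}\left(2\sin\left(\frac{k\lambda}{2}\right)\right)^{-2}q^{k\beta},\qquad \tilde{F}^0(t)=\sum_{\beta>0}n^0_\beta\,\mathrm{Li}_3(q^\beta),\qquad q^\beta=\exp(2\pi i t^\beta),$$ where $t$ denotes the set of all formal variables $t^\beta$, $\beta>0$, regarded as independent variables. Fix $\alpha\in H_2(X,\mathbb{Z})$, $\alpha>0$, and write $t^\circ=t\setminus\{t^\alpha\}$. Then $\tilde{F}_{GV_0}$ satisfies the following difference equation in the variable $t^\alpha$: $$\tilde{F}_{GV_0}(\lambda,t^\circ,t^\alpha+\check{\lambda})-2\tilde{F}_{GV_0}(\lambda,t)+\tilde{F}_{GV_0}(\lambda,t^\circ,t^\alpha-\check{\lambda})=\left(\frac{1}{2\pi}\frac{\partial}{\partial t^\alpha}\right)^2\tilde{F}^0(t),\qquad \check{\lambda}=\frac{\lambda}{2\pi}.$$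
   Context: The Gromov-Witten (GW) potential of a Calabi-Yau threefold $X$ is the formal power series $F(\lambda,t)=\sum_{g\ge0}\lambda^{2g-2}\sum_{\beta\in H_2(X,\mathbb{Z})}N^g_\beta q^\beta$, with $N^g_\beta$ the GW invariants, $\lambda$ a formal parameter and $q^\beta=\exp(2\pi i t^\beta)$ formal variables; $\tilde{F}$ denotes its part coming from non-constant maps ($\beta\neq0$). The Gopakumar-Vafa (GV) invariants $n^g_\beta$ are the numbers (conjecturally integers) for which $$\tilde{F}(\lambda,t)=\sum_{\beta>0}\sum_{g\ge0}n^g_\beta\sum_{k\ge1}\frac{1}{k}\left(2\sin\left(\frac{k\lambda}{2}\right)\right)^{2g-2}q^{k\beta}.$$ The function $\tilde{F}_{GV_0}$ is the contribution of the genus zero GV invariants to this resummed potential. The sums over $\beta>0$ run over nonzero effective curve classes, and $q^{k\beta}$ stands for $(q^\beta)^k=\exp(2\pi i k t^\beta)$. The variables $t^\beta$ for different $\beta>0$ are treated as independent formal variables (no relations such as $t^{2\beta}=2t^\beta$ are imposed), so the summands with $\beta\neq\alpha$ do not depend on $t^\alpha$. Here $\mathrm{Li}_s(z)=\sum_{n=1}^\infty z^n/n^s$. The expression $(2\sin(k\lambda/2))^{-2}$ is understood through its Laurent expansion in $\lambda$ at $0$, and the shifts $t^\alpha\mapsto t^\alpha\pm\check{\lambda}$ are understood by formal Taylor expansion in $\check\lambda$ (equivalently $q^\alpha\mapsto e^{\pm i\lambda}q^\alpha$); the identity is one of formal series. *)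

theory Defs
  imports
    "HOL-Analysis.Analysis"
    "HOL-Computational_Algebra.Formal_Laurent_Series"
    "HOL-Library.Multiset"
    "HOL-Library.Function_Algebras"
begin

section \<open>Curve classes, Gromov-Witten and Gopakumar-Vafa numbers\<close>

text \<open>
  The type \<open>'h\<close> plays the role of \<open>H\<^sub>2(X,\<int>)\<close>, \<open>Eff\<close> that of the set of classes
  \<open>\<beta> > 0\<close> (nonzero effective curve classes), and \<open>N g \<beta>\<close> that of the Gromov-Witten invariant
  of genus \<open>g\<close> and class \<open>\<beta>\<close>. The axioms are the properties of effective classes which make
  the potentials below well defined: nonzero effective classes are closed under addition, and
  each of them splits into two such classes in only finitely many ways.
\<close>

locale GW_data =
  fixes Eff :: "'h::ab_group_add set"
    and N :: "nat \<Rightarrow> 'h \<Rightarrow> complex"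
  assumes zero_not_effective: "0 \<notin> Eff"
    and effective_add: "\<lbrakk>\<beta> \<in> Eff; \<gamma> \<in> Eff\<rbrakk> \<Longrightarrow> \<beta> + \<gamma> \<in> Eff"
    and finite_splittings: "\<gamma> \<in> Eff \<Longrightarrow> finite {\<beta> \<in> Eff. \<gamma> - \<beta> \<in> Eff}"
    and GW_vanish: "\<lbrakk>\<beta> \<noteq> 0; \<beta> \<notin> Eff\<rbrakk> \<Longrightarrow> N g \<beta> = 0"

text \<open>
  The formal parameter \<open>\<lambda>\<close> is \<^term>\<open>fls_X :: complex fls\<close>. Infinite sums in \<^typ>\<open>complex fls\<close>
  refer to the topology of the library, which is the \<open>\<lambda>\<close>-adic one.
\<close>

definition two_sin :: "nat \<Rightarrow> complex fls" where
  "two_sin k = 2 * fps_to_fls (fps_sin (of_nat k / 2))"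

text \<open>The coefficient of \<open>q\<^sup>\<gamma>\<close>, \<open>\<gamma> \<noteq> 0\<close>, in the Gromov-Witten potential.\<close>

definition GW_potential :: "(nat \<Rightarrow> 'h \<Rightarrow> complex) \<Rightarrow> 'h \<Rightarrow> complex fls" where
  "GW_potential N \<gamma> = (\<Sum>g. fls_const (N g \<gamma>) * fls_X powi (2 * int g - 2))"

text \<open>
  The coefficient of \<open>q\<^sup>\<gamma>\<close> in the resummed potential. Here, and only here, \<open>q\<^bsup>k\<beta>\<^esup>\<close> is the
  variable attached to the class \<open>k\<beta>\<close>, so the terms that contribute are those with \<open>k\<beta> = \<gamma>\<close>.
  For \<^locale>\<open>GW_data\<close> and \<open>\<gamma> \<in> Eff\<close> there are finitely many such pairs \<open>(\<beta>, k)\<close>.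
\<close>

definition GV_potential :: "'h::ab_group_add set \<Rightarrow> (nat \<Rightarrow> 'h \<Rightarrow> complex) \<Rightarrow> 'h \<Rightarrow> complex fls" where
  "GV_potential Eff n \<gamma> =
     (\<Sum>(\<beta>, k) \<in> {(\<beta>, k). \<beta> \<in> Eff \<and> 1 \<le> k \<and> (\<Sum>i<k. \<beta>) = \<gamma>}.
        \<Sum>g. fls_const (n g \<beta>) * fls_const (1 / of_nat k) * two_sin k powi (2 * int g - 2))"

definition GV_invariants ::
    "'h::ab_group_add set \<Rightarrow> (nat \<Rightarrow> 'h \<Rightarrow> complex) \<Rightarrow> (nat \<Rightarrow> 'h \<Rightarrow> complex) \<Rightarrow> bool" where
  "GV_invariants Eff N n \<longleftrightarrow> (\<forall>\<gamma>. \<gamma> \<noteq> 0 \<longrightarrow> GW_potential N \<gamma> = GV_potential Eff n \<gamma>)"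

section \<open>Formal series in independent variables\<close>

text \<open>
  A formal series in independent variables \<open>q\<^sup>\<beta> = exp (2\<pi>i t\<^sup>\<beta>)\<close>, with coefficients formal
  Laurent series in \<open>\<lambda>\<close>, is given by its coefficients. The multiset \<open>M\<close> stands for the monomial
  in which \<open>q\<^sup>\<beta>\<close> has the exponent \<^term>\<open>count M \<beta>\<close>. In particular \<open>(q\<^sup>\<beta>)\<^sup>2\<close> and \<open>q\<^bsup>2\<beta>\<^esup>\<close> are
  different monomials.
\<close>

type_synonym 'h qseries = "'h multiset \<Rightarrow> complex fls"

definition qscale :: "complex fls \<Rightarrow> 'h qseries \<Rightarrow> 'h qseries" where
  "qscale c F = (\<lambda>M. c * F M)"

definition q_power :: "'h \<Rightarrow> nat \<Rightarrow> 'h qseries" where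
  "q_power \<beta> k = (\<lambda>M. if M = replicate_mset k \<beta> then 1 else 0)"

text \<open>
  Infinite sums of such series are taken coefficientwise. (In the sums below all but finitely many
  terms contribute zero to any given monomial.) The operations \<open>+\<close> and \<open>-\<close> on series are coefficientwise as well.
\<close>

definition qsum :: "('i \<Rightarrow> 'h qseries) \<Rightarrow> 'i set \<Rightarrow> 'h qseries" where
  "qsum F I = (\<lambda>M. \<Sum>\<^sub>\<infinity>i\<in>I. F i M)"

definition Li_q :: "nat \<Rightarrow> 'h \<Rightarrow> 'h qseries" where
  "Li_q s \<beta> = qsum (\<lambda>k. qscale (fls_const (1 / of_nat k ^ s)) (q_power \<beta> k)) {1..}"

text \<open>
  \<open>\<partial>/\<partial>t\<^sup>\<alpha>\<close> acts on a monomial by \<open>2\<pi>i\<close> times the exponent of \<open>q\<^sup>\<alpha> = exp (2\<pi>i t\<^sup>\<alpha>)\<close>; the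
  substitution \<open>t\<^sup>\<alpha> \<mapsto> t\<^sup>\<alpha> + s\<close> is the formal Taylor expansion in \<open>s\<close>.
\<close>

definition deriv_t :: "'h \<Rightarrow> 'h qseries \<Rightarrow> 'h qseries" where
  "deriv_t \<alpha> F = (\<lambda>M. fls_const (2 * of_real pi * \<i> * of_nat (count M \<alpha>)) * F M)"

definition shift_t :: "'h \<Rightarrow> complex fls \<Rightarrow> 'h qseries \<Rightarrow> 'h qseries" where
  "shift_t \<alpha> s F = (\<lambda>M. \<Sum>m. s ^ m * fls_const (1 / fact m) * (deriv_t \<alpha> ^^ m) F M)"

definition lambda_check :: "complex fls" where
  "lambda_check = fls_const (1 / (2 * of_real pi)) * fls_X"

section \<open>The genus zero contributions\<close>

definition F_GV0 :: "'h set \<Rightarrow> ('h \<Rightarrow> complex) \<Rightarrow> 'h qseries" where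
  "F_GV0 Eff n0 =
     qsum (\<lambda>\<beta>. qscale (fls_const (n0 \<beta>))
       (qsum (\<lambda>k. qscale (fls_const (1 / of_nat k) * two_sin k powi (-2)) (q_power \<beta> k)) {1..})) Eff"

definition F0 :: "'h set \<Rightarrow> ('h \<Rightarrow> complex) \<Rightarrow> 'h qseries" where
  "F0 Eff n0 = qsum (\<lambda>\<beta>. qscale (fls_const (n0 \<beta>)) (Li_q 3 \<beta>)) Eff"

end

theory Submission
  imports Defs
begin

text \<open>
  Both sides are compared one monomial \<open>M\<close> at a time. Write \<open>c\<close> for the exponent of \<open>q\<^sup>\<alpha>\<close> in
  \<open>M\<close>. The operator \<open>\<partial>/\<partial>t\<^sup>\<alpha>\<close> multiplies the coefficient of \<open>M\<close> by \<open>2\<pi>ic\<close>, so the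
  substitution \<open>t\<^sup>\<alpha> \<mapsto> t\<^sup>\<alpha> \<plusminus> \<lambda>/2\<pi>\<close> multiplies it by \<open>exp (\<plusminus>ic\<lambda>)\<close>, and the second
  difference multiplies it by \<open>exp (ic\<lambda>) + exp (-ic\<lambda>) - 2 = -(2 sin (c\<lambda>/2))\<^sup>2\<close>
  (lemma \<open>second_difference_t\<close>). The operator on the right-hand side multiplies it by
  \<open>-c\<^sup>2\<close> (lemma \<open>normalised_second_deriv_t\<close>).

  The variables being independent, a monomial \<open>M\<close> that contains \<open>q\<^sup>\<alpha>\<close> has a nonzero
  coefficient in one of the two potentials only if \<open>M = (q\<^sup>\<alpha>)\<^sup>k\<close>, and then only the summand of
  \<open>\<alpha>\<close> with covering number \<open>k = c\<close> contributes. In the genus zero potential the factor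
  \<open>-(2 sin (k\<lambda>/2))\<^sup>2\<close> cancels the inverse square in this summand and leaves
  \<open>-n\<^sup>0\<^sub>\<alpha>/k\<close>. On the other side \<open>-k\<^sup>2\<close> times the coefficient \<open>n\<^sup>0\<^sub>\<alpha>/k\<^sup>3\<close> of the
  trilogarithm is the same number. When \<open>c = 0\<close> both factors vanish.
\<close>

section \<open>Power series in the \<open>\<lambda>\<close>-adic topology\<close>

lemma dist_fls_le_if_nth_eq:
  fixes a b :: "'a::group_add fls"
  assumes "\<And>i. i < int d \<Longrightarrow> fls_nth a i = fls_nth b i"
  shows "dist a b \<le> (1/2) ^ d"
proof (cases "a = b")
  case False
  then have "int d \<le> fls_subdegree (a - b)"
    using assms by (intro fls_subdegree_geI) auto
  then show ?thesis
    using False by (auto simp: dist_fls_def power_divide field_simps intro!: power_increasing)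
qed auto

text \<open>
  The \<open>\<lambda>\<close>-adic sum behind the Taylor expansion of a shift: \<open>A\<close> will be an exponential series and
  \<open>G\<close> a coefficient of a potential, which may have a pole at \<open>\<lambda> = 0\<close>. The tail of the series is
  divisible by a high power of \<open>\<lambda>\<close>, which multiplication by the fixed series \<open>G\<close> does not spoil.
\<close>

lemma fls_mult_fps_sums:
  fixes A :: "'a::comm_ring_1 fps" and G :: "'a fls"
  shows "(\<lambda>m. fls_const (fps_nth A m) * fls_X ^ m * G) sums (fps_to_fls A * G)"
proof -
  define S where "S = (\<lambda>n. \<Sum>m<n. fls_const (fps_nth A m) * fls_X ^ m * G)"
  have S_eq: "fps_to_fls A * G - S n = fls_X ^ n * (fps_to_fls (fps_shift n A) * G)" for n
  proof -
    have "(\<Sum>m<n. fls_const (fps_nth A m) * fls_X ^ m)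
        = fps_to_fls (\<Sum>m<n. fps_const (fps_nth A m) * fps_X ^ m)"
      by (induction n) (simp_all add: fls_times_fps_to_fls fps_to_fls_power)
    then have "S n = fps_to_fls (\<Sum>m<n. fps_const (fps_nth A m) * fps_X ^ m) * G"
      unfolding S_def sum_distrib_right[symmetric] by simp
    also have "(\<Sum>m<n. fps_const (fps_nth A m) * fps_X ^ m) = fps_cutoff n A"
      by (auto simp: fps_eq_iff fps_sum_nth fps_X_power_nth if_distrib cong: if_cong)
    finally have "fps_to_fls A * G - S n = fps_to_fls (A - fps_cutoff n A) * G"
      by (simp add: algebra_simps)
    also have "A - fps_cutoff n A = fps_X ^ n * fps_shift n A"
      using fps_shift_cutoff[of n A] by (simp add: algebra_simps)
    finally show ?thesis
      by (simp add: fls_times_fps_to_fls fps_to_fls_power mult.assoc)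
  qed
  \<comment> \<open>Multiplication by \<open>G\<close> lowers the order by at most its pole order, and this number of
      additional terms makes the partial sums correct in all exponents below \<open>d\<close>.\<close>
  have agree: "fls_nth (S n) i = fls_nth (fps_to_fls A * G) i"
    if "d + nat (- fls_subdegree G) \<le> n" "i < int d" for d n i
  proof -
    let ?H = "fps_to_fls (fps_shift n A) * G"
    have "fls_nth (fls_X ^ n * ?H) i = fls_nth ?H (i - int n)"
      by (simp add: fls_X_power_times_conv_shift)
    also have "\<dots> = 0"
    proof (rule ccontr)
      assume nz: "fls_nth ?H (i - int n) \<noteq> 0"
      then have "?H \<noteq> 0" by auto
      then have "fls_subdegree G \<le> fls_subdegree ?H"
        using fls_mult_subdegree_ge[of "fps_to_fls (fps_shift n A)" G]
          fls_subdegree_fls_to_fps_gt0[of "fps_shift n A"] by linarith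
      moreover have "fls_subdegree ?H \<le> i - int n"
        using nz by (meson fls_eq0_below_subdegree not_le)
      ultimately show False using that by linarith
    qed
    finally show ?thesis
      using S_eq[of n] by (metis eq_iff_diff_eq_0 fls_minus_nth)
  qed
  have "S \<longlonglongrightarrow> fps_to_fls A * G"
  proof (rule metric_LIMSEQ_I)
    fix r :: real assume "0 < r"
    then obtain d where d: "(1/2) ^ d < r"
      using real_arch_pow_inv[of r "1/2"] by auto
    have "dist (S n) (fps_to_fls A * G) < r" if "n \<ge> d + nat (- fls_subdegree G)" for n
      using dist_fls_le_if_nth_eq[OF agree[OF that]] d by (rule le_less_trans)
    then show "\<exists>n0. \<forall>n\<ge>n0. dist (S n) (fps_to_fls A * G) < r" by blast
  qed
  then show ?thesis unfolding sums_def S_def .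
qed

section \<open>Shifts and derivatives act diagonally on monomials\<close>

lemma deriv_t_funpow:
  "(deriv_t \<alpha> ^^ m) F M = fls_const ((2 * of_real pi * \<i> * of_nat (count M \<alpha>)) ^ m) * F M"
  by (induction m) (simp_all add: deriv_t_def mult.assoc flip: fls_const_mult_const)

lemma shift_t_lambda:
  "shift_t \<alpha> (fls_const (z / (2 * of_real pi)) * fls_X) F M
     = fps_to_fls (fps_exp (z * \<i> * of_nat (count M \<alpha>))) * F M"
proof -
  let ?c = "of_nat (count M \<alpha>) :: complex"
  have summand: "(fls_const (z / (2 * of_real pi)) * fls_X) ^ m * fls_const (1 / fact m) * (deriv_t \<alpha> ^^ m) F M
          = fls_const (fps_nth (fps_exp (z * \<i> * ?c)) m) * fls_X ^ m * F M" for m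
  proof -
    have "(z / (2 * of_real pi)) ^ m * (1 / fact m) * (2 * of_real pi * \<i> * ?c) ^ m
            = (z * \<i> * ?c) ^ m / fact m"
      by (simp add: power_mult_distrib power_divide field_simps)
    then have "fls_const (fps_nth (fps_exp (z * \<i> * ?c)) m)
        = fls_const (z / (2 * of_real pi)) ^ m * fls_const (1 / fact m)
            * fls_const ((2 * of_real pi * \<i> * ?c) ^ m)"
      by (simp only: fps_exp_nth of_nat_fact fls_const_mult_const flip: fls_const_power)
    then show ?thesis
      by (simp only: deriv_t_funpow power_mult_distrib ac_simps)
  qed
  show ?thesis
    unfolding shift_t_def summand by (rule sums_unique[OF fls_mult_fps_sums, symmetric])
qed

text \<open>
  With \<open>e = exp (ik\<lambda>/2)\<close> the left-hand side is \<open>e\<^sup>2 + e\<^sup>-\<^sup>2 - 2 = (e - e\<^sup>-\<^sup>1)\<^sup>2\<close>, and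
  \<open>e - e\<^sup>-\<^sup>1 = 2i sin (k\<lambda>/2)\<close>.
\<close>

lemma fps_exp_second_difference:
  "fps_exp (\<i> * of_nat k) + fps_exp (- \<i> * of_nat k) - 2
     = - (2 * fps_sin (of_nat k / 2))\<^sup>2" (is "?L = ?R")
proof -
  let ?e = "fps_exp (\<i> * (of_nat k / 2) :: complex)" and ?f = "fps_exp (- (\<i> * (of_nat k / 2)) :: complex)"
  have 1: "?e * ?f = 1" by (simp flip: fps_exp_add_mult)
  have 2: "fps_exp (\<i> * of_nat k) = ?e\<^sup>2" "fps_exp (- \<i> * of_nat k) = ?f\<^sup>2"
    by (simp_all add: power2_eq_square flip: fps_exp_add_mult)
  have "?e - ?f = fps_const \<i> * (2 * fps_sin (of_nat k / 2))"
    unfolding fps_exp_ii_sin_cos fps_exp_minus_ii_sin_cos by (simp add: algebra_simps)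
  then have "(?e - ?f)\<^sup>2 = (fps_const \<i>)\<^sup>2 * (2 * fps_sin (of_nat k / 2))\<^sup>2"
    by (simp add: power_mult_distrib)
  also have "(fps_const \<i>)\<^sup>2 = -1"
    by (simp add: power2_eq_square fps_eq_iff)
  finally have "(?e - ?f)\<^sup>2 = ?R" by simp
  moreover have "(?e - ?f)\<^sup>2 = ?e\<^sup>2 + ?f\<^sup>2 - 2 * (?e * ?f)"
    by (simp add: power2_diff)
  ultimately show ?thesis unfolding 1 2 by simp
qed

lemma second_difference_t:
  "(shift_t \<alpha> lambda_check F - qscale 2 F + shift_t \<alpha> (- lambda_check) F) M
     = - (two_sin (count M \<alpha>))\<^sup>2 * F M"
proof -
  let ?c = "of_nat (count M \<alpha>) :: complex"
  have "shift_t \<alpha> lambda_check F M = fps_to_fls (fps_exp (\<i> * ?c)) * F M"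
    using shift_t_lambda[of \<alpha> 1 F M] by (simp add: lambda_check_def)
  moreover have "shift_t \<alpha> (- lambda_check) F M = fps_to_fls (fps_exp (- \<i> * ?c)) * F M"
    using shift_t_lambda[of \<alpha> "-1" F M] by (simp add: lambda_check_def)
  ultimately have "(shift_t \<alpha> lambda_check F - qscale 2 F + shift_t \<alpha> (- lambda_check) F) M
      = fps_to_fls (fps_exp (\<i> * ?c) + fps_exp (- \<i> * ?c) - 2) * F M"
    by (simp add: qscale_def algebra_simps)
  then show ?thesis
    unfolding fps_exp_second_difference
    by (simp add: two_sin_def fps_to_fls_power fls_times_fps_to_fls power_mult_distrib)
qed

lemma normalised_second_deriv_t:
  "((\<lambda>G. qscale (fls_const (1 / (2 * of_real pi))) (deriv_t \<alpha> G)) ^^ 2) F M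
     = - fls_const ((of_nat (count M \<alpha>))\<^sup>2) * F M"
proof -
  let ?c = "of_nat (count M \<alpha>) :: complex"
  have "1 / (2 * of_real pi) * (2 * of_real pi * \<i> * ?c) = \<i> * ?c"
    by simp
  then have "qscale (fls_const (1 / (2 * of_real pi))) (deriv_t \<alpha> G) M = fls_const (\<i> * ?c) * G M" for G
    by (simp only: qscale_def deriv_t_def mult.assoc[symmetric] fls_const_mult_const)
  moreover have "\<i> * ?c * (\<i> * ?c) = - (?c\<^sup>2)"
    by (simp add: power2_eq_square algebra_simps)
  then have "fls_const (\<i> * ?c) * (fls_const (\<i> * ?c) * x) = - fls_const (?c\<^sup>2) * x" for x
    by (simp only: mult.assoc[symmetric] fls_const_mult_const fls_const_uminus)
  ultimately show ?thesis
    unfolding numeral_2_eq_2 by simp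
qed

section \<open>Coefficients of the potentials\<close>

lemma infsum_single_support:
  fixes f :: "'a \<Rightarrow> 'b::{comm_monoid_add, t2_space}"
  assumes "\<And>x. x \<in> A \<Longrightarrow> x \<noteq> a \<Longrightarrow> f x = 0"
  shows "infsum f A = (if a \<in> A then f a else 0)"
proof (cases "a \<in> A")
  case True
  then have "infsum f A = infsum f {a}"
    using assms by (intro infsum_cong_neutral) auto
  then show ?thesis using True by simp
next
  case False
  then show ?thesis using assms by (auto intro: infsum_0)
qed

text \<open>
  The common shape of the resummed potential and of the genus zero part, so that their coefficients
  are found by one computation. The factor \<open>g k\<close> belongs to the \<open>k\<close>-fold covers.
\<close>

definition multicover :: "'h set \<Rightarrow> ('h \<Rightarrow> complex) \<Rightarrow> (nat \<Rightarrow> complex fls) \<Rightarrow> 'h qseries" where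
  "multicover E w g = qsum (\<lambda>\<beta>. qscale (fls_const (w \<beta>))
     (qsum (\<lambda>k. qscale (g k) (q_power \<beta> k)) {1..})) E"

lemma F_GV0_eq_multicover:
  "F_GV0 E w = multicover E w (\<lambda>k. fls_const (1 / of_nat k) * two_sin k powi (-2))"
  unfolding F_GV0_def multicover_def ..

lemma F0_eq_multicover: "F0 E w = multicover E w (\<lambda>k. fls_const (1 / of_nat k ^ 3))"
  unfolding F0_def Li_q_def multicover_def ..

text \<open>
  Independence of the variables enters here: if \<open>q\<^sup>\<alpha>\<close> occurs in a monomial \<open>(q\<^sup>\<beta>)\<^sup>k\<close>, then
  \<open>\<beta> = \<alpha>\<close>. With the relation \<open>(q\<^sup>\<beta>)\<^sup>2 = q\<^bsup>2\<beta>\<^esup>\<close> imposed, several classes could contribute.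
\<close>

lemma multicover_nth_mixed:
  assumes "\<And>k. 1 \<le> k \<Longrightarrow> M \<noteq> replicate_mset k \<alpha>" "\<alpha> \<in># M"
  shows "multicover E w g M = 0"
proof -
  have "M \<noteq> replicate_mset k \<beta>" if "1 \<le> k" for k \<beta>
    using assms that by (metis in_replicate_mset)
  then show ?thesis
    by (auto simp: multicover_def qsum_def qscale_def q_power_def intro!: infsum_0)
qed

lemma multicover_nth_replicate:
  assumes "\<alpha> \<in> E" "1 \<le> k"
  shows "multicover E w g (replicate_mset k \<alpha>) = fls_const (w \<alpha>) * g k"
proof -
  have inj: "replicate_mset k \<alpha> = replicate_mset l \<beta> \<longleftrightarrow> l = k \<and> \<beta> = \<alpha>" for l \<beta>
    using \<open>1 \<le> k\<close> by (auto simp: replicate_mset_eq_iff)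
  have "qsum (\<lambda>l. qscale (g l) (q_power \<beta> l)) {1..} (replicate_mset k \<alpha>)
          = (if \<beta> = \<alpha> then g k else 0)" for \<beta>
    unfolding qsum_def qscale_def q_power_def inj
    using \<open>1 \<le> k\<close> by (subst infsum_single_support[where a = k]) auto
  then show ?thesis
    unfolding multicover_def qsum_def[of _ E] qscale_def[of "fls_const _"]
    using \<open>\<alpha> \<in> E\<close> by (subst infsum_single_support[where a = \<alpha>]) auto
qed

lemma two_sin_nonzero:
  assumes "1 \<le> k"
  shows "two_sin k \<noteq> 0"
proof -
  have "fps_nth (fps_sin (of_nat k / 2 :: complex)) 1 \<noteq> 0"
    using assms by simp
  then have "fps_sin (of_nat k / 2 :: complex) \<noteq> 0"
    by (metis fps_zero_nth)
  then show ?thesis by (simp add: two_sin_def)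
qed

theorem corollary3:
  fixes Eff :: "'h::ab_group_add set"
    and N n :: "nat \<Rightarrow> 'h \<Rightarrow> complex"
    and \<alpha> :: 'h
  assumes "GW_data Eff N"
    and "GV_invariants Eff N n"
    and "\<alpha> \<in> Eff"
  shows "shift_t \<alpha> lambda_check (F_GV0 Eff (n 0)) - qscale 2 (F_GV0 Eff (n 0))
           + shift_t \<alpha> (- lambda_check) (F_GV0 Eff (n 0))
         = ((\<lambda>G. qscale (fls_const (1 / (2 * of_real pi))) (deriv_t \<alpha> G)) ^^ 2) (F0 Eff (n 0))"
proof
  fix M :: "'h multiset"
  have "(two_sin (count M \<alpha>))\<^sup>2 * F_GV0 Eff (n 0) M
          = fls_const ((of_nat (count M \<alpha>))\<^sup>2) * F0 Eff (n 0) M"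
  proof (cases "\<alpha> \<in># M")
    case False
    then show ?thesis by (simp add: not_in_iff two_sin_def)
  next
    case True
    show ?thesis
    proof (cases "\<exists>k\<ge>1. M = replicate_mset k \<alpha>")
      case False
      with True show ?thesis
        by (simp add: F_GV0_eq_multicover F0_eq_multicover multicover_nth_mixed[of M \<alpha>])
    next
      case True
      then obtain k where k: "1 \<le> k" "M = replicate_mset k \<alpha>" by blast
      have "(two_sin k)\<^sup>2 * two_sin k powi (-2) = 1"
        using two_sin_nonzero[OF k(1)] by (simp add: power_int_minus)
      then have "(two_sin k)\<^sup>2 * (fls_const (n 0 \<alpha>) * (fls_const (1 / of_nat k) * two_sin k powi (-2)))
          = fls_const (n 0 \<alpha>) * fls_const (1 / of_nat k)"
        by (metis (no_types, lifting) mult.assoc mult.commute mult.right_neutral)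
      also have "\<dots> = fls_const ((of_nat k)\<^sup>2) * (fls_const (n 0 \<alpha>) * fls_const (1 / of_nat k ^ 3))"
        using k(1) by (simp only: fls_const_mult_const) (simp add: field_simps power2_eq_square power3_eq_cube)
      finally show ?thesis
        using k \<open>\<alpha> \<in> Eff\<close> by (simp add: F_GV0_eq_multicover F0_eq_multicover multicover_nth_replicate)
    qed
  qed
  then show "(shift_t \<alpha> lambda_check (F_GV0 Eff (n 0)) - qscale 2 (F_GV0 Eff (n 0))
           + shift_t \<alpha> (- lambda_check) (F_GV0 Eff (n 0))) M
         = ((\<lambda>G. qscale (fls_const (1 / (2 * of_real pi))) (deriv_t \<alpha> G)) ^^ 2) (F0 Eff (n 0)) M"
    by (simp only: second_difference_t normalised_second_deriv_t mult_minus_left)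
qed

end
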